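(* Let $m,n\in\mathbb{N}$ be fixed positive integers. Consider a sequence of $m\times n$ contingency tables $(x_{ij})_{1\le i\le m,\,1\le j\le n}$ of non-negative integer cell counts (depending on the table in the sequence), with total sample size $N=\sum_{i,j}x_{ij}\to\infty$ along the sequence. Assume that, for all $i,j$, the proportions $x_{ij}/N$ converge along the sequence to a limit $p_{ij}$ with $p_{ij}>0$. Let $P_F$ be the $p$-value of Fisher's exact test of the table $(x_{ij})$ (with fixed marginal totals), and let $MI$ be the mutual information computed from the empirical proportions $x_{ij}/N$. Then, as $N\to\infty$ along the sequence, $$-\frac{1}{N}\log P_F = MI + O\!\left(\frac{\log(N+1)}{N}\right).$$
   Context: All logarithms are natural. For an $m\times n$ table $x=(x_{ij})$ of non-negative integers with total $N$, write $a_i=\sum_{j=1}^n x_{ij}$ and $b_j=\sum_{i=1}^m x_{ij}$ for the marginal totals. For a table $y=(y_{ij})$ of non-negative integers with the same marginal totals $a_1,\dots,a_m$, $b_1,\dots,b_n$, define the (hypergeometric) probability $$P_C(y)=\frac{\prod_{i=1}^m a_i!\,\prod_{j=1}^n b_j!}{N!\,\prod_{i,j}y_{ij}!}.$$ Let $P_H=P_C(x)$ be the probability of the observed table $x$. Fisher's exact (two-sided) $p$-value is $$P_F=\sum_{y:\;P_C(y)\le P_H}P_C(y),$$ where the sum runs over all $m\times n$ tables $y$ of non-negative integers with row sums $a_i$ and column sums $b_j$ satisfying $P_C(y)\le P_H$. The empirical mutual information is $$MI=\sum_{i=1}^m\sum_{j=1}^n \frac{x_{ij}}{N}\log\frac{x_{ij}/N}{(a_i/N)(b_j/N)},$$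 with the convention that terms with $x_{ij}=0$ equal $0$. Both $P_F$ and $MI$ depend on the table in the sequence. The notation $O(\log(N+1)/N)$ means that the absolute value of the error is at most a constant (independent of $N$ along the sequence) times $\log(N+1)/N$ for all sufficiently large $N$. *)

theory Defs
  imports "HOL-Analysis.Analysis" "HOL-Library.Landau_Symbols"
begin

text \<open>
  A table with rows indexed by \<open>'m\<close> and columns indexed by \<open>'n\<close> is an element of
  \<open>nat ^ 'n ^ 'm\<close>; the number of rows is \<open>CARD('m)\<close>, the number of columns \<open>CARD('n)\<close>.
\<close>

definition row_total :: "nat ^ 'n ^ 'm \<Rightarrow> 'm \<Rightarrow> nat" where
  "row_total x i = (\<Sum>j\<in>UNIV. x $ i $ j)"

definition col_total :: "nat ^ 'n ^ 'm \<Rightarrow> 'n \<Rightarrow> nat" where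
  "col_total x j = (\<Sum>i\<in>UNIV. x $ i $ j)"

definition table_total :: "nat ^ 'n ^ 'm \<Rightarrow> nat" where
  "table_total x = (\<Sum>i\<in>UNIV. \<Sum>j\<in>UNIV. x $ i $ j)"

definition same_margins :: "nat ^ 'n ^ 'm \<Rightarrow> (nat ^ 'n ^ 'm) set" where
  "same_margins x =
     {y. (\<forall>i. row_total y i = row_total x i) \<and> (\<forall>j. col_total y j = col_total x j)}"

text \<open>
  The probability of \<open>y\<close> given the margins of \<open>x\<close>; it is meaningful for
  \<open>y \<in> same_margins x\<close>.
\<close>

definition table_prob :: "nat ^ 'n ^ 'm \<Rightarrow> nat ^ 'n ^ 'm \<Rightarrow> real" where
  "table_prob x y =
     ((\<Prod>i\<in>UNIV. fact (row_total x i)) * (\<Prod>j\<in>UNIV. fact (col_total x j))) /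
     (fact (table_total x) * (\<Prod>i\<in>UNIV. \<Prod>j\<in>UNIV. fact (y $ i $ j)))"

definition fisher_p_value :: "nat ^ 'n ^ 'm \<Rightarrow> real" where
  "fisher_p_value x =
     (\<Sum>y\<in>{y \<in> same_margins x. table_prob x y \<le> table_prob x x}. table_prob x y)"

definition mutual_info :: "nat ^ 'n ^ 'm \<Rightarrow> real" where
  "mutual_info x =
     (let N = real (table_total x) in
      \<Sum>i\<in>UNIV. \<Sum>j\<in>UNIV.
        if x $ i $ j = 0 then 0
        else real (x $ i $ j) / N *
          ln ((real (x $ i $ j) / N) /
              ((real (row_total x i) / N) * (real (col_total x j) / N))))"

text \<open>The sum defining the p-value is over a finite set.\<close>

lemma finite_same_margins:
  fixes x :: "nat ^ 'n::finite ^ 'm::finite"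
  shows "finite (same_margins x)"
proof -
  define B where "B = Max (range (row_total x))"
  have le: "y $ i $ j \<le> B" if "y \<in> same_margins x" for y i j
  proof -
    have "y $ i $ j \<le> row_total y i"
      unfolding row_total_def by (rule member_le_sum) auto
    also have "\<dots> = row_total x i"
      using that by (simp add: same_margins_def)
    also have "\<dots> \<le> B"
      unfolding B_def by (rule Max_ge) auto
    finally show ?thesis .
  qed
  let ?F = "PiE UNIV (\<lambda>_. {..B}) :: ('m \<times> 'n \<Rightarrow> nat) set"
  have "same_margins x \<subseteq> (\<lambda>f. \<chi> i j. f (i, j)) ` ?F"
  proof
    fix y assume y: "y \<in> same_margins x"
    have "y = (\<chi> i j. (\<lambda>(i, j). y $ i $ j) (i, j))"
      by (simp add: vec_eq_iff)
    moreover have "(\<lambda>(i, j). y $ i $ j) \<in> ?F"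
      using le[OF y] by (auto simp: PiE_iff)
    ultimately show "y \<in> (\<lambda>f. \<chi> i j. f (i, j)) ` ?F"
      by (rule image_eqI)
  qed
  moreover have "finite ?F"
    by (intro finite_PiE) auto
  ultimately show ?thesis
    by (meson finite_imageI finite_subset)
qed

end

theory Submission
  imports Defs
begin

text \<open>
  The observed table belongs to the summation range, and every summand is at most \<open>P\<^sub>H\<close>. As there
  are at most \<open>(N + 1)\<^bsup>mn\<^esup>\<close> tables with the given margins, \<open>ln P\<^sub>F\<close> and \<open>ln P\<^sub>H\<close> differ by at
  most \<open>mn ln (N + 1)\<close>. By Stirling's formula \<open>ln k! = k ln k - k + O(ln k + 1)\<close>, the linear
  terms in \<open>- ln P\<^sub>H\<close> cancel, and the terms \<open>k ln k\<close> add up to \<open>N MI\<close>.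
\<close>

section \<open>Elementary Stirling bounds for \<open>ln (fact n)\<close>\<close>

lemma ln_Suc_minus_ln_bounds:
  assumes "n > 0"
  shows "1 / real (Suc n) \<le> ln (real (Suc n)) - ln (real n)"
    and "ln (real (Suc n)) - ln (real n) \<le> 1 / real n"
proof -
  have "ln (real n / real (Suc n)) \<le> real n / real (Suc n) - 1"
    using assms by (intro ln_le_minus_one) auto
  also have "\<dots> = - (1 / real (Suc n))"
    by (simp add: field_simps)
  finally show "1 / real (Suc n) \<le> ln (real (Suc n)) - ln (real n)"
    using assms by (simp add: ln_div)
  have "ln (real (Suc n) / real n) \<le> real (Suc n) / real n - 1"
    using assms by (intro ln_le_minus_one) auto
  also have "\<dots> = 1 / real n"
    using assms by (simp add: field_simps)
  finally show "ln (real (Suc n)) - ln (real n) \<le> 1 / real n"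
    using assms by (simp add: ln_div)
qed

text \<open>For \<open>n = 0\<close> the bounds below hold by the convention \<open>ln 0 = 0\<close>.\<close>

lemma ln_fact_ge: "real n * ln (real n) - real n \<le> ln (fact n)"
proof (induction n)
  case (Suc n)
  \<comment> \<open>From \<open>n\<close> to \<open>n + 1\<close> the right side grows by
    \<open>ln (n + 1)\<close>, the left side by
    \<open>ln (n + 1) + n * (ln (n + 1) - ln n) - 1\<close>.\<close>
  have "real n * (ln (real (Suc n)) - ln (real n)) \<le> 1"
    using mult_left_mono[OF ln_Suc_minus_ln_bounds(2)[of n], of "real n"]
    by (cases "n = 0") auto
  with Suc show ?case
    by (simp add: ln_mult algebra_simps del: of_nat_Suc) (simp add: algebra_simps)
qed simp

lemma ln_fact_le: "ln (fact n) \<le> real n * ln (real n) - real n + 1 + ln (real n)"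
proof (induction n)
  case (Suc n)
  \<comment> \<open>For \<open>n > 0\<close> the right side grows by
    \<open>ln (n + 1) + (n + 1) * (ln (n + 1) - ln n) - 1\<close>, hence by at least
    \<open>ln (n + 1)\<close>. For \<open>n = 0\<close> the convention \<open>ln 0 = 0\<close>
    spoils this argument, but the claim for \<open>fact 1\<close> reads 0 \<le> 0, thanks to the
    summand 1.\<close>
  show ?case
  proof (cases "n = 0")
    case False
    have "1 \<le> real (Suc n) * (ln (real (Suc n)) - ln (real n))"
      using mult_left_mono[OF ln_Suc_minus_ln_bounds(1)[of n], of "real (Suc n)"] False by simp
    with Suc show ?thesis
      by (simp add: ln_mult algebra_simps del: of_nat_Suc) (simp add: algebra_simps)
  qed simp
qed simp

text \<open>Every factorial in the table probability has an argument of at most \<open>N\<close>, so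
  one error bound serves for all of them.\<close>

lemma abs_ln_fact_minus_le:
  assumes "n \<le> N" "N > 0"
  shows "\<bar>ln (fact n) - (real n * ln (real n) - real n)\<bar> \<le> 1 + ln (real N)"
proof -
  have "ln (real n) \<le> ln (real N)"
    using assms by (cases "n = 0") auto
  then show ?thesis
    using ln_fact_ge[of n] ln_fact_le[of n] by linarith
qed

section \<open>Entries, margins and the number of tables\<close>

lemma table_total_eq_sum_row_total: "table_total x = (\<Sum>i\<in>UNIV. row_total x i)"
  by (simp add: table_total_def row_total_def)

lemma table_total_eq_sum_col_total: "table_total x = (\<Sum>j\<in>UNIV. col_total x j)"
  unfolding table_total_def col_total_def by (rule sum.swap)

lemma entry_le_row_total: "x $ i $ j \<le> row_total x i"
  for x :: "nat ^ 'n::finite ^ 'm::finite"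
  unfolding row_total_def by (rule member_le_sum) auto

lemma entry_le_col_total: "x $ i $ j \<le> col_total x j"
  for x :: "nat ^ 'n::finite ^ 'm::finite"
  unfolding col_total_def by (rule member_le_sum) auto

lemma row_total_le_table_total: "row_total x i \<le> table_total x"
  for x :: "nat ^ 'n::finite ^ 'm::finite"
  unfolding table_total_eq_sum_row_total by (rule member_le_sum) auto

lemma col_total_le_table_total: "col_total x j \<le> table_total x"
  for x :: "nat ^ 'n::finite ^ 'm::finite"
  unfolding table_total_eq_sum_col_total by (rule member_le_sum) auto

lemma entry_le_table_total: "x $ i $ j \<le> table_total x"
  for x :: "nat ^ 'n::finite ^ 'm::finite"
  using entry_le_row_total row_total_le_table_total by (rule order_trans)

text \<open>Each entry lies in {0, ..., N}, so the tables are images of functions from the mn index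
  pairs into a set of N + 1 elements. For fixed m and n this is polynomial in N, which costs only
  O(ln N) after taking logarithms.\<close>

lemma card_same_margins_le:
  fixes x :: "nat ^ 'n::finite ^ 'm::finite"
  shows "card (same_margins x) \<le> (table_total x + 1) ^ (CARD('m) * CARD('n))"
proof -
  let ?F = "PiE UNIV (\<lambda>_. {..table_total x}) :: ('m \<times> 'n \<Rightarrow> nat) set"
  have "y \<in> (\<lambda>f. \<chi> i j. f (i, j)) ` ?F" if "y \<in> same_margins x" for y
  proof (rule image_eqI)
    show "y = (\<chi> i j. (\<lambda>(i, j). y $ i $ j) (i, j))"
      by (simp add: vec_eq_iff)
    have "table_total y = table_total x"
      using that by (simp add: same_margins_def table_total_eq_sum_row_total)
    then show "(\<lambda>(i, j). y $ i $ j) \<in> ?F"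
      using entry_le_table_total[of y] by (auto simp: PiE_iff)
  qed
  then have "card (same_margins x) \<le> card ?F"
    by (intro surj_card_le[of ?F _ "\<lambda>f. \<chi> i j. f (i, j)"] finite_PiE) auto
  also have "\<dots> = (table_total x + 1) ^ (CARD('m) * CARD('n))"
    by (simp add: card_PiE card_cartesian_product flip: UNIV_Times_UNIV)
  finally show ?thesis .
qed

section \<open>Comparison of the p-value with the probability of the observed table\<close>

lemma table_prob_pos: "table_prob x y > 0"
  unfolding table_prob_def by (intro divide_pos_pos mult_pos_pos prod_pos) auto

lemma table_prob_le_fisher_p_value: "table_prob x x \<le> fisher_p_value x"
  for x :: "nat ^ 'n::finite ^ 'm::finite"
  unfolding fisher_p_value_def
  by (rule member_le_sum)
    (auto simp: same_margins_def less_imp_le[OF table_prob_pos]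
      intro: finite_subset[OF _ finite_same_margins[of x]])

lemma fisher_p_value_le:
  fixes x :: "nat ^ 'n::finite ^ 'm::finite"
  shows "fisher_p_value x \<le> real (table_total x + 1) ^ (CARD('m) * CARD('n)) * table_prob x x"
proof -
  let ?A = "{y \<in> same_margins x. table_prob x y \<le> table_prob x x}"
  have "fisher_p_value x \<le> real (card ?A) * table_prob x x"
    unfolding fisher_p_value_def by (rule sum_bounded_above) auto
  also have "card ?A \<le> card (same_margins x)"
    by (rule card_mono[OF finite_same_margins]) auto
  also note card_same_margins_le[of x]
  finally show ?thesis
    using table_prob_pos[of x x] by (simp add: mult_right_mono less_imp_le)
qed

lemma abs_ln_fisher_p_value_minus_le:
  fixes x :: "nat ^ 'n::finite ^ 'm::finite"
  shows "\<bar>ln (fisher_p_value x) - ln (table_prob x x)\<bar>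
           \<le> real (CARD('m) * CARD('n)) * ln (real (table_total x) + 1)"
proof -
  have "ln (table_prob x x) \<le> ln (fisher_p_value x)"
    using table_prob_le_fisher_p_value[of x] table_prob_pos[of x x] by simp
  moreover have "ln (fisher_p_value x)
      \<le> ln (real (table_total x + 1) ^ (CARD('m) * CARD('n)) * table_prob x x)"
    using fisher_p_value_le[of x] table_prob_le_fisher_p_value[of x] table_prob_pos[of x x]
    by (subst ln_le_cancel_iff) (auto intro!: mult_pos_pos)
  ultimately show ?thesis
    using table_prob_pos[of x x] by (simp add: ln_mult ln_realpow add.commute)
qed

section \<open>Probability of the observed table and mutual information\<close>

lemma ln_table_prob:
  fixes x :: "nat ^ 'n::finite ^ 'm::finite"
  shows "ln (table_prob x y) =
    (\<Sum>i\<in>UNIV. ln (fact (row_total x i))) + (\<Sum>j\<in>UNIV. ln (fact (col_total x j)))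
      - ln (fact (table_total x)) - (\<Sum>i\<in>UNIV. \<Sum>j\<in>UNIV. ln (fact (y $ i $ j)))"
proof -
  have "ln (\<Prod>i\<in>UNIV. \<Prod>j\<in>UNIV. fact (y $ i $ j) :: real)
          = (\<Sum>i\<in>UNIV. \<Sum>j\<in>UNIV. ln (fact (y $ i $ j)))"
    by (simp add: ln_prod prod_pos)
  then show ?thesis
    unfolding table_prob_def by (simp add: ln_div ln_mult ln_prod prod_pos)
qed

text \<open>Split the logarithm in each summand. A factor depending on the row alone collects the
  entries of that row into the row total, and likewise for columns. The resulting terms
  \<open>k * ln k\<close> are those of Stirling's formula, up to a common sign.\<close>

lemma table_total_mult_mutual_info:
  fixes x :: "nat ^ 'n::finite ^ 'm::finite"
  assumes "table_total x > 0"
  shows "real (table_total x) * mutual_info x =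
    (\<Sum>i\<in>UNIV. \<Sum>j\<in>UNIV. real (x $ i $ j) * ln (real (x $ i $ j)))
      + real (table_total x) * ln (real (table_total x))
      - (\<Sum>i\<in>UNIV. real (row_total x i) * ln (real (row_total x i)))
      - (\<Sum>j\<in>UNIV. real (col_total x j) * ln (real (col_total x j)))"
proof -
  let ?N = "real (table_total x)"
  \<comment> \<open>Empty cells satisfy this because every term carries the factor
    \<open>x $ i $ j\<close>. A nonempty cell forces both of its margins to be positive, so the
    logarithm splits.\<close>
  have summand: "?N * (if x $ i $ j = 0 then 0 else real (x $ i $ j) / ?N *
        ln ((real (x $ i $ j) / ?N) /
          ((real (row_total x i) / ?N) * (real (col_total x j) / ?N))))
      = real (x $ i $ j) * ln (real (x $ i $ j)) + real (x $ i $ j) * ln ?N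
        - real (x $ i $ j) * ln (real (row_total x i))
        - real (x $ i $ j) * ln (real (col_total x j))" for i j
  proof (cases "x $ i $ j = 0")
    case False
    then have "row_total x i > 0" "col_total x j > 0"
      using entry_le_row_total[of x i j] entry_le_col_total[of x i j] by auto
    with False assms show ?thesis
      by (simp add: ln_div ln_mult algebra_simps)
  qed simp
  have "?N * mutual_info x = (\<Sum>i\<in>UNIV. \<Sum>j\<in>UNIV.
      real (x $ i $ j) * ln (real (x $ i $ j)) + real (x $ i $ j) * ln ?N
        - real (x $ i $ j) * ln (real (row_total x i))
        - real (x $ i $ j) * ln (real (col_total x j)))"
    unfolding mutual_info_def Let_def sum_distrib_left summand ..
  also have "\<dots> = (\<Sum>i\<in>UNIV. \<Sum>j\<in>UNIV. real (x $ i $ j) * ln (real (x $ i $ j)))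
      + (\<Sum>i\<in>UNIV. \<Sum>j\<in>UNIV. real (x $ i $ j) * ln ?N)
      - (\<Sum>i\<in>UNIV. \<Sum>j\<in>UNIV. real (x $ i $ j) * ln (real (row_total x i)))
      - (\<Sum>i\<in>UNIV. \<Sum>j\<in>UNIV. real (x $ i $ j) * ln (real (col_total x j)))"
    by (simp add: sum.distrib sum_subtractf)
  also have "(\<Sum>i\<in>UNIV. \<Sum>j\<in>UNIV. real (x $ i $ j) * ln ?N) = ?N * ln ?N"
    by (simp add: table_total_def sum_distrib_right)
  also have "(\<Sum>i\<in>UNIV. \<Sum>j\<in>UNIV. real (x $ i $ j) * ln (real (row_total x i)))
      = (\<Sum>i\<in>UNIV. real (row_total x i) * ln (real (row_total x i)))"
    by (intro sum.cong refl) (subst sum_distrib_right[symmetric], simp add: row_total_def)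
  also have "(\<Sum>i\<in>UNIV. \<Sum>j\<in>UNIV. real (x $ i $ j) * ln (real (col_total x j)))
      = (\<Sum>j\<in>UNIV. real (col_total x j) * ln (real (col_total x j)))"
    by (subst sum.swap, intro sum.cong refl)
      (subst sum_distrib_right[symmetric], simp add: col_total_def)
  finally show ?thesis .
qed

text \<open>The factor (m + 1)(n + 1) = m + n + 1 + mn counts the factorials: rows, columns, total
  and cells. Each contributes one Stirling error.\<close>

lemma abs_ln_table_prob_plus_mutual_info_le:
  fixes x :: "nat ^ 'n::finite ^ 'm::finite"
  assumes N: "table_total x > 0"
  shows "\<bar>ln (table_prob x x) + real (table_total x) * mutual_info x\<bar>
           \<le> real ((CARD('m) + 1) * (CARD('n) + 1)) * (1 + ln (real (table_total x)))"
proof -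
  define e where "e n = ln (fact n) - (real n * ln (real n) - real n)" for n
  define B where "B = 1 + ln (real (table_total x))"
  have ln_fact_eq: "ln (fact n) = real n * ln (real n) - real n + e n" for n
    by (simp add: e_def)
  have e: "\<bar>e n\<bar> \<le> B" if "n \<le> table_total x" for n
    unfolding e_def B_def using that N by (rule abs_ln_fact_minus_le)
  have "\<bar>\<Sum>i\<in>UNIV. e (row_total x i)\<bar> \<le> real CARD('m) * B"
    by (rule order_trans[OF sum_abs sum_bounded_above])
      (simp add: e row_total_le_table_total)
  moreover have "\<bar>\<Sum>j\<in>UNIV. e (col_total x j)\<bar> \<le> real CARD('n) * B"
    by (rule order_trans[OF sum_abs sum_bounded_above])
      (simp add: e col_total_le_table_total)
  moreover have "\<bar>e (table_total x)\<bar> \<le> B"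
    by (simp add: e)
  moreover have "\<bar>\<Sum>j\<in>UNIV. e (x $ i $ j)\<bar> \<le> real CARD('n) * B" for i
    by (rule order_trans[OF sum_abs sum_bounded_above])
      (simp add: e entry_le_table_total)
  then have "\<bar>\<Sum>i\<in>UNIV. \<Sum>j\<in>UNIV. e (x $ i $ j)\<bar> \<le> real CARD('m) * (real CARD('n) * B)"
    by (rule order_trans[OF sum_abs sum_bounded_above])
  \<comment> \<open>Only errors remain: the arguments in each of the four groups of factorials sum
    to N, so the linear terms give -N - N + N + N = 0, and the terms \<open>k * ln k\<close> cancel
    against \<open>N * MI\<close>.\<close>
  moreover have "ln (table_prob x x) + real (table_total x) * mutual_info x =
      (\<Sum>i\<in>UNIV. e (row_total x i)) + (\<Sum>j\<in>UNIV. e (col_total x j))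
        - e (table_total x) - (\<Sum>i\<in>UNIV. \<Sum>j\<in>UNIV. e (x $ i $ j))"
  proof -
    have "(\<Sum>i\<in>UNIV. real (row_total x i)) = real (table_total x)"
      by (simp add: table_total_eq_sum_row_total)
    moreover have "(\<Sum>j\<in>UNIV. real (col_total x j)) = real (table_total x)"
      by (simp add: table_total_eq_sum_col_total)
    moreover have "(\<Sum>i\<in>UNIV. \<Sum>j\<in>UNIV. real (x $ i $ j)) = real (table_total x)"
      by (simp add: table_total_def)
    ultimately show ?thesis
      unfolding ln_table_prob table_total_mult_mutual_info[OF N] ln_fact_eq
      by (simp add: sum.distrib sum_subtractf)
  qed
  ultimately show ?thesis
    unfolding B_def[symmetric] by (simp add: algebra_simps)
qed

text \<open>The 4 is 3 + 1: three for the Stirling errors, since 1 + ln N \<le> 3 ln (N + 1), and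
  one for the number of tables, since mn \<le> (m + 1)(n + 1).\<close>

lemma abs_fisher_p_value_mutual_info_le:
  fixes x :: "nat ^ 'n::finite ^ 'm::finite"
  assumes "table_total x > 0"
  shows "\<bar>- (1 / real (table_total x)) * ln (fisher_p_value x) - mutual_info x\<bar>
           \<le> 4 * real ((CARD('m) + 1) * (CARD('n) + 1)) *
               (ln (real (table_total x) + 1) / real (table_total x))"
proof -
  let ?N = "real (table_total x)" and ?c = "real ((CARD('m) + 1) * (CARD('n) + 1))"
  \<comment> \<open>As N \<ge> 1, ln (N + 1) \<ge> ln 2 \<ge> 2/3, so 2 ln (N + 1) absorbs the
    summand 1.\<close>
  have "ln 2 \<le> ln (?N + 1)" "ln ?N \<le> ln (?N + 1)"
    using assms by auto
  then have "1 + ln ?N \<le> 3 * ln (?N + 1)"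
    using ln2_ge_two_thirds by linarith
  then have "?c * (1 + ln ?N) \<le> ?c * (3 * ln (?N + 1))"
    by (rule mult_left_mono) simp
  moreover have "real (CARD('m) * CARD('n)) * ln (?N + 1) \<le> ?c * ln (?N + 1)"
    by (rule mult_right_mono) (simp_all add: mult_mono)
  ultimately have "\<bar>ln (fisher_p_value x) + ?N * mutual_info x\<bar> \<le> 4 * ?c * ln (?N + 1)"
    using abs_ln_fisher_p_value_minus_le[of x] abs_ln_table_prob_plus_mutual_info_le[OF assms]
    by linarith
  then have "\<bar>ln (fisher_p_value x) + ?N * mutual_info x\<bar> / ?N \<le> 4 * ?c * ln (?N + 1) / ?N"
    by (rule divide_right_mono) simp
  moreover have "- (1 / ?N) * ln (fisher_p_value x) - mutual_info x
      = - ((ln (fisher_p_value x) + ?N * mutual_info x) / ?N)"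
    using assms by (simp add: field_simps)
  ultimately show ?thesis
    by (simp add: abs_divide)
qed

theorem theorem3:
  fixes x :: "nat \<Rightarrow> nat ^ 'n::finite ^ 'm::finite" and p :: "real ^ 'n ^ 'm"
  assumes "filterlim (\<lambda>k. table_total (x k)) at_top sequentially"
    and "\<And>i j. (\<lambda>k. real (x k $ i $ j) / real (table_total (x k))) \<longlonglongrightarrow> p $ i $ j"
    and "\<And>i j. p $ i $ j > 0"
  shows "(\<lambda>k. - (1 / real (table_total (x k))) * ln (fisher_p_value (x k)) - mutual_info (x k))
           \<in> O(\<lambda>k. ln (real (table_total (x k)) + 1) / real (table_total (x k)))"
proof (rule bigoI)
  \<comment> \<open>The constant of the explicit bound depends on m and n alone, so the bound is
    uniform along the sequence once the totals are positive.\<close>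
  have "\<forall>\<^sub>F k in sequentially. table_total (x k) > 0"
    using assms(1) unfolding filterlim_at_top by (simp add: Suc_le_eq[symmetric])
  then show "\<forall>\<^sub>F k in sequentially.
      norm (- (1 / real (table_total (x k))) * ln (fisher_p_value (x k)) - mutual_info (x k))
        \<le> 4 * real ((CARD('m) + 1) * (CARD('n) + 1)) *
          norm (ln (real (table_total (x k)) + 1) / real (table_total (x k)))"
  proof eventually_elim
    case (elim k)
    then show ?case
      using abs_fisher_p_value_mutual_info_le[of "x k"] by simp
  qed
qed

end
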